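(* Let $\mathbf{x}=[\underline{x},\overline{x}]\subseteq\mathbb{R}^n$ be a box, $x^0\in\mathbf{x}$ and $h\in\mathbb{R}^n$. Let $\widetilde{\lambda}_i$ ($i=1,\dots,n$) and the breakpoints $0=\lambda_1<\lambda_2<\dots<\lambda_m<\lambda_{m+1}=+\infty$ be as defined in the context. Then the candidate solution $$x(\lambda):=\sup\{\underline{x},\inf\{x^0-\lambda h,\overline{x}\}\}$$ of the problem of maximizing $E_{\gamma,h}(x)$ over $x\in\mathbf{x}$ has the form $$x(\lambda)=p^k+\lambda q^k\quad\text{for }\lambda\in[\lambda_k,\lambda_{k+1}]\qquad(k=1,2,\dots,m),$$ where $$p_i^k=\begin{cases}x_i^0 & \text{if } h_i=0,\\ x_i^0 & \text{if } \lambda_{k+1}\le\widetilde{\lambda}_i,\\ \underline{x}_i & \text{if } \lambda_k\ge\widetilde{\lambda}_i,\ h_i>0,\\ \overline{x}_i & \text{if } \lambda_k\ge\widetilde{\lambda}_i,\ h_i<0,\end{cases}\qquad q_i^k=\begin{cases}0 & \text{if } h_i=0,\\ -h_i & \text{if } \lambda_{k+1}\le\widetilde{\lambda}_i,\\ 0 & \text{if } \lambda_k\ge\widetilde{\lambda}_i,\ h_i>0,\\ 0 & \text{if } \lambda_k\ge\widetilde{\lambda}_i,\ h_i<0.\end{cases}$$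
   Context: A box $\mathbf{x}=[\underline{x},\overline{x}]$ is the nonempty set of all $x\in\mathbb{R}^n$ with $\underline{x}_i\le x_i\le\overline{x}_i$ for all $i$, where lower bounds may be $-\infty$ and upper bounds may be $+\infty$. The operations $\sup$ and $\inf$ of two vectors are componentwise, so $x(\lambda)$ is the projection of $x^0-\lambda h$ onto $\mathbf{x}$. Here $E_{\gamma,h}(x)=-\frac{\gamma+\langle h,x\rangle}{Q(x)}$ with $\gamma\in\mathbb{R}$, $Q(x)=Q_0+\frac12\|x-x^0\|_2^2$, $Q_0>0$ (this only identifies the problem that $x(\lambda)$ is meant to solve). For $i=1,\dots,n$ define $$\widetilde{\lambda}_i:=\begin{cases}-\dfrac{\overline{x}_i-x_i^0}{h_i} & \text{if } h_i<0,\\[2mm] -\dfrac{\underline{x}_i-x_i^0}{h_i} & \text{if } h_i>0,\\[1mm] +\infty & \text{if } h_i=0,\end{cases}$$ which lies in $[0,+\infty]$ (it is $+\infty$ if the relevant bound is infinite). Sorting the values $\widetilde{\lambda}_1,\dots,\widetilde{\lambda}_n$ in increasing order, augmenting the list by $0$ and $+\infty$, and deleting duplicates gives the list of $m+1\le n+2$ breakpoints $0=\lambda_1<\lambda_2<\dots<\lambda_m<\lambda_{m+1}=+\infty$. For $k=m$ the interval $[\lambda_k,\lambda_{k+1}]$ is understood as the set of real $\lambda\ge\lambda_m$. *)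

theory Defs
  imports "HOL-Analysis.Analysis"
begin

abbreviation ereal_vec :: "real^'n \<Rightarrow> ereal^'n" where
  "ereal_vec x \<equiv> (\<chi> i. ereal (x $ i))"

text \<open>Bounds are extended-real vectors; the points of the box are real vectors.
  Nonemptiness of the box rules out the lower bound \<open>\<infinity>\<close> and the upper bound \<open>-\<infinity>\<close>.\<close>

definition ebox :: "ereal^'n \<Rightarrow> ereal^'n \<Rightarrow> (real^'n) set" where
  "ebox xl xu = {x. \<forall>i. xl $ i \<le> ereal (x $ i) \<and> ereal (x $ i) \<le> xu $ i}"

definition lam_tilde :: "ereal^'n \<Rightarrow> ereal^'n \<Rightarrow> real^'n \<Rightarrow> real^'n \<Rightarrow> 'n \<Rightarrow> ereal" where
  "lam_tilde xl xu x0 h i =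
    (if h $ i < 0 then - ((xu $ i - ereal (x0 $ i)) / ereal (h $ i))
     else if h $ i > 0 then - ((xl $ i - ereal (x0 $ i)) / ereal (h $ i))
     else \<infinity>)"

definition breakpoint_list ::
    "ereal^'n \<Rightarrow> ereal^'n \<Rightarrow> real^'n \<Rightarrow> real^'n \<Rightarrow> ereal list" where
  "breakpoint_list xl xu x0 h =
    sorted_list_of_set ({0, \<infinity>} \<union> range (lam_tilde xl xu x0 h))"

text \<open>The breakpoints are numbered from \<open>1\<close> to \<open>m + 1\<close>, where \<open>m\<close> is \<open>num_pieces\<close>.\<close>

definition breakpoint ::
    "ereal^'n \<Rightarrow> ereal^'n \<Rightarrow> real^'n \<Rightarrow> real^'n \<Rightarrow> nat \<Rightarrow> ereal" where
  "breakpoint xl xu x0 h k = breakpoint_list xl xu x0 h ! (k - 1)"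

definition num_pieces :: "ereal^'n \<Rightarrow> ereal^'n \<Rightarrow> real^'n \<Rightarrow> real^'n \<Rightarrow> nat" where
  "num_pieces xl xu x0 h = length (breakpoint_list xl xu x0 h) - 1"

text \<open>Since the bounds may be infinite, the candidate is formed in the extended reals.
  No information is discarded by a conversion to the reals.\<close>

definition candidate ::
    "ereal^'n \<Rightarrow> ereal^'n \<Rightarrow> real^'n \<Rightarrow> real^'n \<Rightarrow> real \<Rightarrow> ereal^'n" where
  "candidate xl xu x0 h lam =
    (\<chi> i. sup (xl $ i) (inf (ereal ((x0 - lam *\<^sub>R h) $ i)) (xu $ i)))"

text \<open>The case distinctions are read top to bottom. The value \<open>undefined\<close> would be taken only
  if no case applied. In the last two cases of \<open>piece_p\<close> the bound is finite whenever
  \<open>breakpoint xl xu x0 h k\<close> is, because \<open>lam_tilde xl xu x0 h i\<close> is \<open>\<infinity>\<close> for an infinite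
  relevant bound; hence \<open>real_of_ereal\<close> is applied there to finite values only.\<close>

definition piece_p ::
    "ereal^'n \<Rightarrow> ereal^'n \<Rightarrow> real^'n \<Rightarrow> real^'n \<Rightarrow> nat \<Rightarrow> real^'n" where
  "piece_p xl xu x0 h k =
    (\<chi> i. if h $ i = 0 then x0 $ i
          else if breakpoint xl xu x0 h (k + 1) \<le> lam_tilde xl xu x0 h i then x0 $ i
          else if breakpoint xl xu x0 h k \<ge> lam_tilde xl xu x0 h i \<and> h $ i > 0
            then real_of_ereal (xl $ i)
          else if breakpoint xl xu x0 h k \<ge> lam_tilde xl xu x0 h i \<and> h $ i < 0
            then real_of_ereal (xu $ i)
          else undefined)"

definition piece_q ::
    "ereal^'n \<Rightarrow> ereal^'n \<Rightarrow> real^'n \<Rightarrow> real^'n \<Rightarrow> nat \<Rightarrow> real^'n" where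
  "piece_q xl xu x0 h k =
    (\<chi> i. if h $ i = 0 then 0
          else if breakpoint xl xu x0 h (k + 1) \<le> lam_tilde xl xu x0 h i then - h $ i
          else if breakpoint xl xu x0 h k \<ge> lam_tilde xl xu x0 h i \<and> h $ i > 0 then 0
          else if breakpoint xl xu x0 h k \<ge> lam_tilde xl xu x0 h i \<and> h $ i < 0 then 0
          else undefined)"

lemma length_breakpoint_list:
  "length (breakpoint_list xl xu x0 h) = card ({0, \<infinity>} \<union> range (lam_tilde xl xu x0 h))"
  unfolding breakpoint_list_def
  by (rule sorted_list_of_set.length_sorted_key_list_of_set)

lemma num_pieces_Suc:
  "num_pieces xl xu x0 h + 1 = card ({0, \<infinity>} \<union> range (lam_tilde xl xu x0 h))"
proof -
  have "0 < card ({0, \<infinity>} \<union> range (lam_tilde xl xu x0 h))"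
    by (subst card_gt_0_iff) auto
  then show ?thesis
    by (simp add: num_pieces_def length_breakpoint_list)
qed

lemma num_pieces_le:
  fixes xl :: "ereal^'n"
  shows "num_pieces xl xu x0 h + 1 \<le> CARD('n) + 2"
proof -
  have "card ({0, \<infinity>::ereal} \<union> range (lam_tilde xl xu x0 h))
      \<le> card {0, \<infinity>::ereal} + card (range (lam_tilde xl xu x0 h))"
    by (rule card_Un_le)
  also have "\<dots> \<le> 2 + CARD('n)"
    by (intro add_mono card_image_le) auto
  finally show ?thesis
    using num_pieces_Suc[of xl xu x0 h] by simp
qed

lemma lam_tilde_nonneg:
  assumes "x0 \<in> ebox xl xu"
  shows "0 \<le> lam_tilde xl xu x0 h i"
proof -
  have "xl $ i \<le> ereal (x0 $ i)" "ereal (x0 $ i) \<le> xu $ i"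
    using assms by (auto simp: ebox_def)
  then show ?thesis
    by (cases "xl $ i"; cases "xu $ i")
      (auto simp: lam_tilde_def divide_nonneg_neg divide_nonpos_pos zero_ereal_def)
qed

lemma breakpoint_strict_mono:
  assumes "1 \<le> j" "j < k" "k \<le> num_pieces xl xu x0 h + 1"
  shows "breakpoint xl xu x0 h j < breakpoint xl xu x0 h k"
proof -
  have "sorted_wrt (<) (breakpoint_list xl xu x0 h)"
    unfolding breakpoint_list_def by (rule strict_sorted_list_of_set)
  moreover have "k - 1 < length (breakpoint_list xl xu x0 h)"
    using assms num_pieces_Suc[of xl xu x0 h] length_breakpoint_list[of xl xu x0 h] by linarith
  ultimately show ?thesis
    using assms by (simp add: breakpoint_def sorted_wrt_nth_less)
qed

lemma breakpoint_image:
  "breakpoint xl xu x0 h ` {1..num_pieces xl xu x0 h + 1} =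
    {0, \<infinity>} \<union> range (lam_tilde xl xu x0 h)"
proof -
  let ?L = "breakpoint_list xl xu x0 h"
  have L: "num_pieces xl xu x0 h + 1 = length ?L"
    using num_pieces_Suc length_breakpoint_list by metis
  have "breakpoint xl xu x0 h ` {1..length ?L} = (!) ?L ` {..<length ?L}"
  proof (intro equalityI subsetI)
    fix y assume "y \<in> breakpoint xl xu x0 h ` {1..length ?L}"
    then show "y \<in> (!) ?L ` {..<length ?L}"
      by (auto simp: breakpoint_def)
  next
    fix y assume "y \<in> (!) ?L ` {..<length ?L}"
    then obtain j where "j < length ?L" "y = ?L ! j" by auto
    then show "y \<in> breakpoint xl xu x0 h ` {1..length ?L}"
      by (intro image_eqI[of _ _ "Suc j"]) (auto simp: breakpoint_def)
  qed
  also have "\<dots> = set ?L"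
    by (auto simp: set_conv_nth)
  finally show ?thesis
    unfolding L breakpoint_list_def by (subst (asm) set_sorted_list_of_set) auto
qed

lemma breakpoint_first:
  assumes "x0 \<in> ebox xl xu"
  shows "breakpoint xl xu x0 h 1 = 0"
proof -
  let ?b = "breakpoint xl xu x0 h" and ?m = "num_pieces xl xu x0 h"
  have "0 \<in> ?b ` {1..?m + 1}"
    unfolding breakpoint_image by simp
  then obtain k where k: "k \<in> {1..?m + 1}" "?b k = 0" by auto
  have "?b 1 \<in> ?b ` {1..?m + 1}" by simp
  then have "0 \<le> ?b 1"
    unfolding breakpoint_image using lam_tilde_nonneg[OF assms, of h] by auto
  then show ?thesis
    using k breakpoint_strict_mono[of 1 k xl xu x0 h] by (cases "k = 1") auto
qed

lemma breakpoint_last: "breakpoint xl xu x0 h (num_pieces xl xu x0 h + 1) = \<infinity>"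
proof -
  let ?b = "breakpoint xl xu x0 h" and ?m = "num_pieces xl xu x0 h"
  have "\<infinity> \<in> ?b ` {1..?m + 1}"
    unfolding breakpoint_image by simp
  then obtain k where k: "k \<in> {1..?m + 1}" "?b k = \<infinity>" by auto
  then show ?thesis
    using breakpoint_strict_mono[of k "?m + 1" xl xu x0 h] by (cases "k = ?m + 1") auto
qed

end

theory Submission
  imports Defs
begin

text \<open>
  Both sides decouple into coordinates. For \<open>\<lambda> \<ge> 0\<close> the \<open>i\<close>-th coordinate of the ray
  \<open>x\<^sup>0 - \<lambda> h\<close> starts inside its interval and moves towards a single bound, the lower one
  if \<open>h\<^sub>i > 0\<close> and the upper one if \<open>h\<^sub>i < 0\<close>, or stays put if \<open>h\<^sub>i = 0\<close>; the value
  \<open>lam_tilde xl xu x0 h i\<close> is the time at which it hits the bound, and \<open>\<infinity>\<close> if it never does. Hence the projection does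
  nothing before that time (lemma \<open>candidate_before_hit\<close>) and returns the bound, which is then
  finite, from that time on (lemmas \<open>candidate_after_hit_lower\<close> and
  \<open>candidate_after_hit_upper\<close>). At the time itself both descriptions agree, which is why the
  pieces may be taken on closed intervals.

  As every hitting time is itself a breakpoint, none lies strictly between two consecutive
  breakpoints (lemma \<open>lam_tilde_not_between\<close>). So on \<open>[\<lambda>\<^sub>k, \<lambda>\<^sub>k\<^sub>+\<^sub>1]\<close> each coordinate stays
  in one of the two regimes, and the regime is the one that the case distinctions of
  \<open>piece_p\<close> and \<open>piece_q\<close> select.
\<close>

lemma lam_tilde_not_between:
  assumes "1 \<le> k" and "k \<le> num_pieces xl xu x0 h"
  shows "lam_tilde xl xu x0 h i \<le> breakpoint xl xu x0 h k \<or>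
    breakpoint xl xu x0 h (k + 1) \<le> lam_tilde xl xu x0 h i"
proof -
  let ?b = "breakpoint xl xu x0 h" and ?m = "num_pieces xl xu x0 h"
  have "lam_tilde xl xu x0 h i \<in> ?b ` {1..?m + 1}"
    unfolding breakpoint_image by simp
  then obtain j where j: "1 \<le> j" "j \<le> ?m + 1" "lam_tilde xl xu x0 h i = ?b j"
    by auto
  consider "j < k" | "j = k" | "j = k + 1" | "k + 1 < j"
    by linarith
  then show ?thesis
    using assms j breakpoint_strict_mono[of j k xl xu x0 h]
      breakpoint_strict_mono[of "k + 1" j xl xu x0 h]
    by cases auto
qed

lemma breakpoint_nonneg:
  assumes "x0 \<in> ebox xl xu" and "1 \<le> k" and "k \<le> num_pieces xl xu x0 h + 1"
  shows "0 \<le> breakpoint xl xu x0 h k"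
proof (cases "k = 1")
  case True
  then show ?thesis
    using breakpoint_first[OF assms(1), of h] by simp
next
  case False
  then show ?thesis
    using breakpoint_strict_mono[of 1 k xl xu x0 h] breakpoint_first[OF assms(1), of h] assms
    by simp
qed

text \<open>The bound on the side from which the ray moves away is respected because \<open>\<lambda> \<ge> 0\<close>,
  and the one towards which it moves because the hitting time has not passed. A coordinate with
  \<open>h\<^sub>i = 0\<close> never moves, in accordance with its hitting time \<open>\<infinity>\<close>.\<close>

lemma candidate_before_hit:
  assumes x0: "x0 \<in> ebox xl xu" and lam: "0 \<le> lam"
    and before: "ereal lam \<le> lam_tilde xl xu x0 h i"
  shows "candidate xl xu x0 h lam $ i = ereal (x0 $ i - lam * h $ i)"
proof -
  have bounds: "xl $ i \<le> ereal (x0 $ i)" "ereal (x0 $ i) \<le> xu $ i"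
    using x0 by (auto simp: ebox_def)
  have "xl $ i \<le> ereal (x0 $ i - lam * h $ i) \<and> ereal (x0 $ i - lam * h $ i) \<le> xu $ i"
  proof (cases "h $ i" "0 :: real" rule: linorder_cases)
    case less
    then have "lam * h $ i \<le> 0"
      using lam by (simp add: mult_nonneg_nonpos)
    then show ?thesis
      using bounds before less
      by (cases "xl $ i"; cases "xu $ i") (auto simp: lam_tilde_def field_simps)
  next
    case equal
    then show ?thesis
      using bounds by simp
  next
    case greater
    then have "0 \<le> lam * h $ i"
      using lam by simp
    then show ?thesis
      using bounds before greater
      by (cases "xl $ i"; cases "xu $ i") (auto simp: lam_tilde_def field_simps)
  qed
  then show ?thesis
    by (simp add: candidate_def inf_absorb1 sup_absorb2)
qed

text \<open>A hitting time bounded by a real number forces the bound that is hit to be finite. This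
  is what makes \<open>real_of_ereal\<close> faithful in \<open>piece_p\<close>, so the bound is stated in that form.\<close>

lemma candidate_after_hit_lower:
  assumes x0: "x0 \<in> ebox xl xu" and h: "0 < h $ i"
    and after: "lam_tilde xl xu x0 h i \<le> ereal lam"
  shows "candidate xl xu x0 h lam $ i = ereal (real_of_ereal (xl $ i))"
proof -
  have bounds: "xl $ i \<le> ereal (x0 $ i)" "ereal (x0 $ i) \<le> xu $ i"
    using x0 by (auto simp: ebox_def)
  obtain l where l: "xl $ i = ereal l"
    using bounds after h by (cases "xl $ i") (auto simp: lam_tilde_def)
  have "x0 $ i - lam * h $ i \<le> l"
    using after h by (simp add: lam_tilde_def l field_simps)
  then have "inf (ereal (x0 $ i - lam * h $ i)) (xu $ i) \<le> xl $ i"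
    by (intro le_infI1) (simp add: l)
  then show ?thesis
    by (simp add: candidate_def sup_absorb1 l)
qed

lemma candidate_after_hit_upper:
  assumes x0: "x0 \<in> ebox xl xu" and h: "h $ i < 0"
    and after: "lam_tilde xl xu x0 h i \<le> ereal lam"
  shows "candidate xl xu x0 h lam $ i = ereal (real_of_ereal (xu $ i))"
proof -
  have bounds: "xl $ i \<le> ereal (x0 $ i)" "ereal (x0 $ i) \<le> xu $ i"
    using x0 by (auto simp: ebox_def)
  obtain u where u: "xu $ i = ereal u"
    using bounds after h by (cases "xu $ i") (auto simp: lam_tilde_def)
  have "u \<le> x0 $ i - lam * h $ i"
    using after h by (simp add: lam_tilde_def u field_simps)
  then have "inf (ereal (x0 $ i - lam * h $ i)) (xu $ i) = xu $ i"
    by (intro inf_absorb2) (simp add: u)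
  moreover have "xl $ i \<le> xu $ i"
    using bounds by (rule order_trans)
  ultimately show ?thesis
    by (simp add: candidate_def sup_absorb2 u)
qed

theorem proposition3p3:
  fixes xl xu :: "ereal^'n" and x0 h :: "real^'n" and k :: nat and lam :: real
  assumes "x0 \<in> ebox xl xu"
    and "1 \<le> k" and "k \<le> num_pieces xl xu x0 h"
    and "breakpoint xl xu x0 h k \<le> ereal lam"
    and "ereal lam \<le> breakpoint xl xu x0 h (k + 1)"
  shows "candidate xl xu x0 h lam =
    ereal_vec (piece_p xl xu x0 h k + lam *\<^sub>R piece_q xl xu x0 h k)"
proof -
  let ?t = "lam_tilde xl xu x0 h" and ?b = "breakpoint xl xu x0 h"
  have lam: "0 \<le> lam"
    using order_trans[OF breakpoint_nonneg assms(4)] assms(1-3) by simp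
  have "candidate xl xu x0 h lam $ i =
      ereal (piece_p xl xu x0 h k $ i + lam * piece_q xl xu x0 h k $ i)" for i
  proof -
    consider (still) "h $ i = 0"
      | (before) "h $ i \<noteq> 0" "?b (k + 1) \<le> ?t i"
      | (lower) "\<not> ?b (k + 1) \<le> ?t i" "?t i \<le> ?b k" "0 < h $ i"
      | (upper) "\<not> ?b (k + 1) \<le> ?t i" "?t i \<le> ?b k" "h $ i < 0"
      using lam_tilde_not_between[OF assms(2,3), of i] by linarith
    then show ?thesis
    proof cases
      case still
      then have "ereal lam \<le> ?t i"
        by (simp add: lam_tilde_def)
      then show ?thesis
        using candidate_before_hit[OF assms(1) lam] still
        by (simp add: piece_p_def piece_q_def)
    next
      case before
      then have "ereal lam \<le> ?t i"
        using assms(5) by order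
      then show ?thesis
        using candidate_before_hit[OF assms(1) lam] before
        by (simp add: piece_p_def piece_q_def)
    next
      case lower
      then have "?t i \<le> ereal lam"
        using assms(4) by order
      then show ?thesis
        using candidate_after_hit_lower[OF assms(1)] lower
        by (simp add: piece_p_def piece_q_def)
    next
      case upper
      then have "?t i \<le> ereal lam"
        using assms(4) by order
      then show ?thesis
        using candidate_after_hit_upper[OF assms(1)] upper
        by (simp add: piece_p_def piece_q_def)
    qed
  qed
  then show ?thesis
    by (simp add: vec_eq_iff)
qed

end
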